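(* Let $f,g:I\to\mathbb{R}$ be strictly increasing functions. Then the following assertions are equivalent. (i) For all $n\in\mathbb{N}$ and $x\in I^n$, $A^{[n]}_{f}(x)\leq A^{[n]}_{g}(x)$. (ii) For all $n\in\mathbb{N}$, $x\in I^n$, and $\lambda\in\Lambda_n$, $\widetilde{A}^{[n]}_{f}(x;\lambda)\leq \widetilde{A}^{[n]}_{g}(x;\lambda)$. (iii) There exists $n\in\mathbb{N}\setminus\{1\}$ such that, for all $x\in I^n$ and $\lambda\in\Lambda_n$, $\widetilde{A}^{[n]}_{f}(x;\lambda)\leq \widetilde{A}^{[n]}_{g}(x;\lambda)$. (iv) For all $x,y\in I$ with $x<y$ and $t\in (x,y)\cap C_f\cap C_g$, $$\frac{f(y)-f(t)}{f(y)-f(x)}\leq\frac{g(y)-g(t)}{g(y)-g(x)}.$$ (v) There exists a positive function $p:C_f\cap C_g\to(0,\infty)$ such that, for all $x\in I$ and $t\in C_f\cap C_g$, $$f(x)-f(t)\leq p(t)(g(x)-g(t)).$$ (vi) There exists an increasing convex homeomorphism $\varphi:\mathrm{conv}(f(I))\to\mathrm{conv}(g(I))$ such that $\varphi(f(x))\leq g(x)$ for all $x\in I$ and $\varphi(f(t))=g(t)$ for all $t\in C_f\cap C_g$. (vii) There exists an increasing concave homeomorphism $\psi:\mathrm{conv}(g(I))\to\mathrm{conv}(f(I))$ such that $f(x)\leq \psi(g(x))$ for all $x\in I$ and $f(t)=\psi(g(t))$ for all $t\in C_f\cap C_g$.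
   Context: $I$ is a nonempty open subinterval of $\mathbb{R}$. "Increasing" means nondecreasing; $\mathrm{conv}(S)$ is the smallest interval containing $S\subseteq\mathbb{R}$. For a strictly increasing (not necessarily continuous) $f:I\to\mathbb{R}$, it is known that there is a unique increasing function $f^{(-1)}:\mathrm{conv}(f(I))\to I$ with $f^{(-1)}(f(x))=x$ for all $x\in I$ (the generalized inverse of $f$; it is continuous). For $n\in\mathbb{N}=\{1,2,\dots\}$ let $\Lambda_n:=\{\lambda\in[0,\infty)^n : \lambda_1+\dots+\lambda_n>0\}$. The $n$-variable generalized quasiarithmetic mean $A_f^{[n]}:I^n\to I$ and its weighted version $\widetilde{A}_f^{[n]}:I^n\times\Lambda_n\to I$ are $$A^{[n]}_{f}(x):=f^{(-1)}\Big(\frac{f(x_1)+\dots+f(x_n)}{n}\Big),\qquad \widetilde{A}^{[n]}_{f}(x;\lambda):=f^{(-1)}\Big(\frac{\lambda_1f(x_1)+\dots+\lambda_nf(x_n)}{\lambda_1+\dots+\lambda_n}\Big).$$ $C_f$ denotes the set of points of $I$ at which $f$ is continuous. *)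

theory Defs
  imports "HOL-Analysis.Analysis"
begin

abbreviation conv :: "real set \<Rightarrow> real set"
  where "conv S \<equiv> is_interval hull S"

lemma conv_eq_convex_hull: "conv S = convex hull S"
  by (metis is_interval_convex_1)

text \<open>Below, \<open>f\<close> is a total function of which only the values on \<open>I\<close> matter.  The generalized
  inverse is extensional (\<open>undefined\<close> off \<open>conv (f ` I)\<close>), so that it is unique as a HOL function.\<close>

definition gen_inv :: "real set \<Rightarrow> (real \<Rightarrow> real) \<Rightarrow> real \<Rightarrow> real"
  where "gen_inv I f = (THE h. h \<in> conv (f ` I) \<rightarrow>\<^sub>E I \<and> mono_on (conv (f ` I)) h \<and>
           (\<forall>x\<in>I. h (f x) = x))"

lemma conv_image_bounds:
  assumes "y \<in> conv (f ` I)"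
  obtains a b where "a \<in> I" "b \<in> I" "f a \<le> y" "y \<le> f b"
proof -
  let ?S = "{z. \<exists>a\<in>I. \<exists>b\<in>I. f a \<le> z \<and> z \<le> f b}"
  have "is_interval ?S"
    unfolding is_interval_1 by (blast intro: order_trans)
  moreover have "f ` I \<subseteq> ?S" by auto
  ultimately have "conv (f ` I) \<subseteq> ?S" by (intro hull_minimal)
  with assms that show thesis by blast
qed

lemma gen_inv_ex1:
  fixes I :: "real set" and f :: "real \<Rightarrow> real"
  assumes I: "is_interval I" and f: "strict_mono_on I f"
  shows "\<exists>!h. h \<in> conv (f ` I) \<rightarrow>\<^sub>E I \<and> mono_on (conv (f ` I)) h \<and> (\<forall>x\<in>I. h (f x) = x)"
proof (rule ex_ex1I)
  let ?J = "conv (f ` I)"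
  let ?A = "\<lambda>y. {x\<in>I. f x \<le> y}"
  define h where "h = restrict (\<lambda>y. Sup (?A y)) ?J"
  have le: "x \<le> x'" if "x \<in> I" "x' \<in> I" "f x \<le> f x'" for x x'
    using strict_mono_onD[OF f, of x' x] that by (meson leD not_le)
  have sub: "f x \<in> ?J" if "x \<in> I" for x
    using that hull_subset[of "f ` I" is_interval] by blast
  have bdd: "bdd_above (?A y)" and ne: "?A y \<noteq> {}" and mem: "Sup (?A y) \<in> I" if y: "y \<in> ?J" for y
  proof -
    obtain a b where ab: "a \<in> I" "b \<in> I" "f a \<le> y" "y \<le> f b"
      using conv_image_bounds[OF y] by blast
    have ub: "x \<le> b" if "x \<in> ?A y" for x using that ab le[of x b] by auto
    show bdd: "bdd_above (?A y)" using ub by (intro bdd_aboveI[of _ b]) auto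
    show ne: "?A y \<noteq> {}" using ab by auto
    have "a \<le> Sup (?A y)" using ab bdd by (intro cSup_upper) auto
    moreover have "Sup (?A y) \<le> b" using ne ub by (intro cSup_least) auto
    ultimately show "Sup (?A y) \<in> I" using I ab unfolding is_interval_1 by blast
  qed
  have "h \<in> ?J \<rightarrow>\<^sub>E I" using mem by (auto simp: h_def)
  moreover have "mono_on ?J h"
  proof (rule mono_onI)
    fix y z assume yz: "y \<in> ?J" "z \<in> ?J" "y \<le> z"
    have "Sup (?A y) \<le> Sup (?A z)"
      using ne[OF yz(1)] bdd[OF yz(2)] yz(3) by (intro cSup_subset_mono) auto
    then show "h y \<le> h z" using yz by (simp add: h_def)
  qed
  moreover have "h (f x) = x" if "x \<in> I" for x
  proof -
    have "Sup (?A (f x)) = x" using that le by (intro cSup_eq_maximum) auto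
    then show ?thesis using sub[OF that] by (simp add: h_def)
  qed
  ultimately show "\<exists>h. h \<in> ?J \<rightarrow>\<^sub>E I \<and> mono_on ?J h \<and> (\<forall>x\<in>I. h (f x) = x)" by blast
next
  let ?J = "conv (f ` I)"
  have sub: "f x \<in> ?J" if "x \<in> I" for x
    using that hull_subset[of "f ` I" is_interval] by blast
  have key: "h y \<le> k y" if h: "h \<in> ?J \<rightarrow>\<^sub>E I \<and> mono_on ?J h \<and> (\<forall>x\<in>I. h (f x) = x)"
    and k: "k \<in> ?J \<rightarrow>\<^sub>E I \<and> mono_on ?J k \<and> (\<forall>x\<in>I. k (f x) = x)" and y: "y \<in> ?J" for h k y
  proof (rule ccontr)
    assume "\<not> h y \<le> k y"
    then obtain z where z: "k y < z" "z < h y" using dense not_le by blast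
    have hk: "h y \<in> I" "k y \<in> I" using h k y by auto
    have zI: "z \<in> I" using I hk z unfolding is_interval_1 by (meson less_imp_le)
    have "f z \<le> y \<or> y \<le> f z" by linarith
    then show False
    proof
      assume "f z \<le> y"
      then have "k (f z) \<le> k y" using k sub[OF zI] y by (meson mono_onD)
      then show False using k zI z by auto
    next
      assume "y \<le> f z"
      then have "h y \<le> h (f z)" using h sub[OF zI] y by (meson mono_onD)
      then show False using h zI z by auto
    qed
  qed
  fix h k
  assume h: "h \<in> ?J \<rightarrow>\<^sub>E I \<and> mono_on ?J h \<and> (\<forall>x\<in>I. h (f x) = x)"
    and k: "k \<in> ?J \<rightarrow>\<^sub>E I \<and> mono_on ?J k \<and> (\<forall>x\<in>I. k (f x) = x)"
  show "h = k"
  proof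
    fix y show "h y = k y"
    proof (cases "y \<in> ?J")
      case True
      show ?thesis by (rule antisym[OF key[OF h k True] key[OF k h True]])
    next
      case False
      then have "h y = undefined" "k y = undefined"
        using h k by (meson PiE_arb)+
      then show ?thesis by simp
    qed
  qed
qed

text \<open>An \<open>n\<close>-tuple is a function on \<open>nat\<close> whose entries are its values on \<open>{1..n}\<close>; values at
  other arguments are irrelevant.\<close>

definition weights :: "nat \<Rightarrow> (nat \<Rightarrow> real) set"
  where "weights n = {l. (\<forall>i\<in>{1..n}. 0 \<le> l i) \<and> 0 < (\<Sum>i=1..n. l i)}"

definition qa_mean :: "real set \<Rightarrow> (real \<Rightarrow> real) \<Rightarrow> nat \<Rightarrow> (nat \<Rightarrow> real) \<Rightarrow> real"
  where "qa_mean I f n x = gen_inv I f ((\<Sum>i=1..n. f (x i)) / real n)"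

definition wqa_mean :: "real set \<Rightarrow> (real \<Rightarrow> real) \<Rightarrow> nat \<Rightarrow> (nat \<Rightarrow> real) \<Rightarrow> (nat \<Rightarrow> real) \<Rightarrow> real"
  where "wqa_mean I f n x l =
           gen_inv I f ((\<Sum>i=1..n. l i * f (x i)) / (\<Sum>i=1..n. l i))"

definition cont_pts :: "real set \<Rightarrow> (real \<Rightarrow> real) \<Rightarrow> real set"
  where "cont_pts I f = {t\<in>I. continuous (at t within I) f}"

text \<open>The following are equivalent.\<close>

definition TFAE :: "bool list \<Rightarrow> bool"
  where "TFAE Ps \<longleftrightarrow> (\<forall>P\<in>set Ps. \<forall>Q\<in>set Ps. P \<longleftrightarrow> Q)"

end

theory Submission
  imports Defs
begin

text \<open>
  Write \<open>J\<^sub>f\<close> and \<open>J\<^sub>g\<close> for the smallest intervals containing \<open>f(I)\<close> and \<open>g(I)\<close>, and \<open>C\<close> for the set of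
  common continuity points of \<open>f\<close> and \<open>g\<close>.  A monotone function has only countably many
  discontinuities, so \<open>C\<close> is dense in \<open>I\<close>; this is what makes information at the points of \<open>C\<close>
  sufficient.

  A comparison of two-variable means with rational weights already forces (iv)
  (\<open>slopes_of_two_point_means\<close>): choose the weight that makes the \<open>f\<close>-mean of \<open>x\<close> and \<open>y\<close> equal
  to \<open>t\<close>, or rational weights that approach it and make the \<open>f\<close>-mean at least \<open>t\<close>.  The \<open>g\<close>-mean
  is then at least \<open>t\<close>, and continuity of \<open>g\<close> at \<open>t\<close> turns this into an inequality between values
  of \<open>g\<close>, which is (iv).  Both (i), by repeating variables, and (iii), by
  setting all but two weights to zero, contain such a comparison.

  Condition (iv) says that for \<open>x < t < y\<close> with \<open>t \<in> C\<close> the quotient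
  \<open>(f(y) - f(t)) / (g(y) - g(t))\<close> is at most \<open>(f(t) - f(x)) / (g(t) - g(x))\<close>, so a number \<open>p(t)\<close> fits
  between all the former and all the latter, which is (v).  Geometrically, (v) states that
  the line through \<open>(f(t), g(t))\<close> with slope \<open>1 / p(t)\<close> runs below the curve \<open>x \<mapsto> (f(x), g(x))\<close>.
  The supremum of these lines is the convex function \<open>\<phi>\<close> of (vi)
  (\<open>convex_homeomorphism_of_slopes\<close>).  It is a bijection from \<open>J\<^sub>f\<close> to \<open>J\<^sub>g\<close> because it is
  convex and increasing, and its values \<open>\<phi>(f(t)) = g(t)\<close> with \<open>t \<in> C\<close> are strictly increasing and
  cofinal in \<open>J\<^sub>g\<close> in both directions.

  Given \<open>\<phi>\<close>, Jensen's inequality bounds \<open>\<phi>\<close> of the weighted mean of the \<open>f(x\<^sub>i)\<close> by the weighted mean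
  of the \<open>g(x\<^sub>i)\<close>.  Applying the increasing function \<open>g\<^sup>(\<^sup>-\<^sup>1\<^sup>)\<close> and using \<open>g\<^sup>(\<^sup>-\<^sup>1\<^sup>) \<circ> \<phi> = f\<^sup>(\<^sup>-\<^sup>1\<^sup>)\<close>
  (\<open>gen_inv_comp_homeomorphism\<close>) gives (ii), which contains (i) and (iii).  Finally (vi) and (vii)
  correspond under \<open>\<psi> = \<phi>\<^sup>-\<^sup>1\<close>.
\<close>

section \<open>Common continuity points and the convex hull of the image\<close>

lemma cont_pts_dense:
  fixes I :: "real set" and f g :: "real \<Rightarrow> real"
  assumes "is_interval I" and "strict_mono_on I f" and "strict_mono_on I g"
    and ab: "a \<in> I" "b \<in> I" "a < b"
  obtains t where "t \<in> cont_pts I f \<inter> cont_pts I g" "a < t" "t < b"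
proof -
  let ?D = "\<lambda>h. {t\<in>I. \<not> continuous (at t within I) h}"
  have "countable (?D f \<union> ?D g)"
    using assms by (simp add: mono_on_ctble_discont strict_mono_on_imp_mono_on)
  moreover have "uncountable {a<..<b}"
    using ab by (simp add: uncountable_open_interval)
  ultimately have "\<not> {a<..<b} \<subseteq> ?D f \<union> ?D g"
    using countable_subset by blast
  then obtain t where "t \<in> {a<..<b}" and D: "t \<notin> ?D f \<union> ?D g" by blast
  then have t: "a < t" "t < b" by simp_all
  moreover have "t \<in> I"
    using assms(1) ab t unfolding is_interval_1 by (meson less_imp_le)
  ultimately show thesis
    using D by (intro that[of t]) (simp_all add: cont_pts_def)
qed

lemma open_interval_nbhd:
  fixes I :: "real set"
  assumes "open I" "t \<in> I"
  obtains a b where "a \<in> I" "b \<in> I" "a < t" "t < b"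
proof -
  obtain e where e: "e > 0" "cball t e \<subseteq> I"
    using assms open_contains_cball by blast
  show thesis
    using e by (intro that[of "t - e" "t + e"]) (auto simp: subset_iff dist_real_def)
qed

lemma image_in_conv: "x \<in> I \<Longrightarrow> f x \<in> conv (f ` I)"
  using hull_subset[of "f ` I" is_interval] by blast

lemma conv_image_convex: "convex (conv (f ` I))"
  by (simp add: conv_eq_convex_hull)

lemma conv_image_between:
  assumes "a \<in> I" "b \<in> I" "f a \<le> y" "y \<le> f b"
  shows "y \<in> conv (f ` I)"
proof -
  have "is_interval (conv (f ` I))" by (simp add: is_interval_convex_1 conv_image_convex)
  then show ?thesis
    using assms(3,4) image_in_conv[OF assms(1), of f] image_in_conv[OF assms(2), of f]
    by (meson mem_is_interval_1_I)
qed

text \<open>Since \<open>I\<close> has no end points, the values of \<open>f\<close> at the points of the dense set \<open>C\<close> are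
  cofinal in the convex hull of the image in both directions.\<close>

lemma conv_image_bounds_cont_pts:
  fixes I :: "real set" and f g h :: "real \<Rightarrow> real"
  assumes I: "open I" "is_interval I" and fg: "strict_mono_on I f" "strict_mono_on I g"
    and h: "strict_mono_on I h" and y: "y \<in> conv (h ` I)"
  obtains s t where "s \<in> cont_pts I f \<inter> cont_pts I g" "t \<in> cont_pts I f \<inter> cont_pts I g"
    "h s < y" "y < h t"
proof -
  obtain a b where ab: "a \<in> I" "b \<in> I" "h a \<le> y" "y \<le> h b"
    using conv_image_bounds[OF y] by blast
  obtain a' where a': "a' \<in> I" "a' < a" using open_interval_nbhd[OF I(1) ab(1)] by blast
  obtain b' where b': "b' \<in> I" "b < b'" using open_interval_nbhd[OF I(1) ab(2)] by blast
  obtain s where s: "s \<in> cont_pts I f \<inter> cont_pts I g" "a' < s" "s < a"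
    using cont_pts_dense[OF I(2) fg a'(1) ab(1) a'(2)] by blast
  obtain t where t: "t \<in> cont_pts I f \<inter> cont_pts I g" "b < t" "t < b'"
    using cont_pts_dense[OF I(2) fg ab(2) b'] by blast
  have "h s < h a" "h b < h t"
    using s t ab h by (auto simp: cont_pts_def intro: strict_mono_onD)
  then show thesis using s t ab by (intro that[of s t]) auto
qed

lemma conv_image_open:
  fixes I :: "real set" and f :: "real \<Rightarrow> real"
  assumes I: "open I" "is_interval I" and f: "strict_mono_on I f"
  shows "open (conv (f ` I))"
proof (subst open_subopen, intro ballI)
  fix y assume "y \<in> conv (f ` I)"
  then obtain s t where "s \<in> I" "t \<in> I" "f s < y" "y < f t"
    by (rule conv_image_bounds_cont_pts[OF I f f f, unfolded cont_pts_def]) blast+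
  then show "\<exists>T. open T \<and> y \<in> T \<and> T \<subseteq> conv (f ` I)"
    using conv_image_between[of s I t f]
    by (intro exI[of _ "{f s<..<f t}"]) (auto simp: less_imp_le)
qed

section \<open>The generalized inverse\<close>

lemma gen_inv_characterization:
  fixes I :: "real set" and f :: "real \<Rightarrow> real"
  assumes "is_interval I" and "strict_mono_on I f"
  shows gen_inv_mem: "y \<in> conv (f ` I) \<Longrightarrow> gen_inv I f y \<in> I"
    and gen_inv_mono: "y \<in> conv (f ` I) \<Longrightarrow> z \<in> conv (f ` I) \<Longrightarrow> y \<le> z \<Longrightarrow>
      gen_inv I f y \<le> gen_inv I f z"
    and gen_inv_image: "x \<in> I \<Longrightarrow> gen_inv I f (f x) = x"
  using theI'[OF gen_inv_ex1[OF assms]] unfolding gen_inv_def[symmetric]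
  by (auto simp: mono_on_def)

text \<open>This can fail if \<open>f\<close> jumps at \<open>t\<close>, because \<open>gen_inv I f\<close> has the value \<open>t\<close> on the whole gap,
  also below \<open>f t\<close>.  If \<open>f\<close> is continuous at \<open>t\<close> and \<open>y < f t\<close>, then \<open>y < f s\<close> already for some
  \<open>s < t\<close>, so that the generalized inverse at \<open>y\<close> is at most \<open>s\<close>.\<close>

lemma le_of_le_gen_inv:
  fixes I :: "real set" and f :: "real \<Rightarrow> real"
  assumes I: "open I" "is_interval I" and f: "strict_mono_on I f"
    and t: "t \<in> cont_pts I f" and y: "y \<in> conv (f ` I)" and le: "t \<le> gen_inv I f y"
  shows "f t \<le> y"
proof (rule ccontr)
  assume "\<not> f t \<le> y"
  then have less: "y < f t" by simp
  have tI: "t \<in> I" using t by (simp add: cont_pts_def)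
  obtain a where a: "a \<in> I" "a < t" using open_interval_nbhd[OF I(1) tI] by blast
  have "isCont f t"
    using t I(1) at_within_open[of t I] by (auto simp: cont_pts_def)
  then have "\<forall>\<^sub>F s in at t. y < f s"
    using less unfolding isCont_def by (rule order_tendstoD)
  then have "\<forall>\<^sub>F s in at_left t. y < f s"
    by (rule filter_leD[OF at_le, rotated]) simp
  moreover have "\<forall>\<^sub>F s in at_left t. a < s \<and> s < t"
    using a by (auto simp: eventually_at_left)
  ultimately have "\<forall>\<^sub>F s in at_left t. y < f s \<and> a < s \<and> s < t"
    by eventually_elim auto
  then obtain s where s: "y < f s" "a < s" "s < t"
    using eventually_happens by force
  have sI: "s \<in> I" using I(2) a tI s unfolding is_interval_1 by (meson less_imp_le)
  have "gen_inv I f y \<le> gen_inv I f (f s)"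
    using gen_inv_mono[OF I(2) f y image_in_conv[OF sI]] s by simp
  then show False using le s gen_inv_image[OF I(2) f sI] by simp
qed

section \<open>From two-variable means to slopes\<close>

text \<open>Unweighted means with repeated variables realize exactly the rational weights.\<close>

definition two_point_le :: "real set \<Rightarrow> (real \<Rightarrow> real) \<Rightarrow> (real \<Rightarrow> real) \<Rightarrow> bool"
  where "two_point_le I f g \<longleftrightarrow> (\<forall>x\<in>I. \<forall>y\<in>I. \<forall>r\<in>\<rat> \<inter> {0<..<1}.
    gen_inv I f (r * f x + (1 - r) * f y) \<le> gen_inv I g (r * g x + (1 - r) * g y))"

lemma two_point_le_of_qa_mean:
  assumes *: "\<forall>n\<ge>1. \<forall>x \<in> {1..n} \<rightarrow> I. qa_mean I f n x \<le> qa_mean I g n x"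
  shows "two_point_le I f g"
  unfolding two_point_le_def
proof (intro ballI)
  fix x y r assume x: "x \<in> I" and y: "y \<in> I" and r: "r \<in> \<rat> \<inter> {0<..<1::real}"
  obtain k n :: nat where kn: "n \<noteq> 0" "r = real k / real n"
    using r Rats_abs_nat_div_natE[of r] by (metis IntE abs_of_pos greaterThanLessThan_iff)
  have "real k < real n" using r kn by (simp add: field_simps)
  then have k: "k \<le> n" by simp
  let ?X = "\<lambda>i. if i \<le> k then x else y"
  have mean: "(\<Sum>i=1..n. h (?X i)) / real n = r * h x + (1 - r) * h y" for h :: "real \<Rightarrow> real"
  proof -
    have "(\<Sum>i=1..n. h (?X i)) = (\<Sum>i=1..n. if i \<le> k then h x else h y)"
      by (intro sum.cong) auto
    also have "\<dots> = (\<Sum>i\<in>{1..k}. h x) + (\<Sum>i\<in>{k+1..n}. h y)"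
    proof -
      have "{1..n} \<inter> {i. i \<le> k} = {1..k}" "{1..n} \<inter> - {i. i \<le> k} = {k+1..n}"
        using k by auto
      then show ?thesis by (subst sum.If_cases) auto
    qed
    also have "\<dots> = real k * h x + (real n - real k) * h y"
      using k by (simp add: of_nat_diff)
    finally have sum: "(\<Sum>i=1..n. h (?X i)) = real k * h x + (real n - real k) * h y" .
    show ?thesis unfolding sum kn(2) using kn(1) by (simp add: field_simps)
  qed
  have "qa_mean I f n ?X \<le> qa_mean I g n ?X"
    using * kn x y by (auto simp: Pi_iff)
  then show "gen_inv I f (r * f x + (1 - r) * f y) \<le> gen_inv I g (r * g x + (1 - r) * g y)"
    unfolding qa_mean_def mean .
qed

lemma two_point_le_of_wqa_mean:
  assumes n: "n \<ge> 2"
    and *: "\<forall>x \<in> {1..n} \<rightarrow> I. \<forall>l \<in> weights n. wqa_mean I f n x l \<le> wqa_mean I g n x l"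
  shows "two_point_le I f g"
  unfolding two_point_le_def
proof (intro ballI)
  fix x y r assume x: "x \<in> I" and y: "y \<in> I" and r: "r \<in> \<rat> \<inter> {0<..<1::real}"
  let ?X = "\<lambda>i::nat. if i = 1 then x else y"
  let ?l = "\<lambda>i::nat. if i = 1 then r else if i = 2 then 1 - r else 0"
  have two: "(\<Sum>i=1..n. ?l i * h i) = r * h 1 + (1 - r) * h 2" for h :: "nat \<Rightarrow> real"
  proof -
    have "(\<Sum>i=1..n. ?l i * h i) = (\<Sum>i\<in>{1,2}. ?l i * h i)"
      using n by (intro sum.mono_neutral_right) auto
    then show ?thesis by simp
  qed
  have one: "(\<Sum>i=1..n. ?l i) = 1" using two[of "\<lambda>_. 1"] by simp
  have "?l \<in> weights n" using one r by (auto simp: weights_def)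
  then have "wqa_mean I f n ?X ?l \<le> wqa_mean I g n ?X ?l"
    using * x y by (auto simp: Pi_iff)
  then show "gen_inv I f (r * f x + (1 - r) * f y) \<le> gen_inv I g (r * g x + (1 - r) * g y)"
    unfolding wqa_mean_def one two by simp
qed

text \<open>With \<open>\<theta> = (f(y) - f(t)) / (f(y) - f(x))\<close> one has \<open>\<theta> f(x) + (1 - \<theta>) f(y) = f(t)\<close>.  Because
  \<open>\<theta>\<close> need not be rational, smaller rational weights \<open>r\<close> are used: they only increase the \<open>f\<close>-mean,
  so that the \<open>g\<close>-mean still is at least \<open>t\<close>, and then \<open>r\<close> tends to \<open>\<theta>\<close>.\<close>

lemma slopes_of_two_point_means:
  fixes I :: "real set" and f g :: "real \<Rightarrow> real"
  assumes I: "open I" "is_interval I" and f: "strict_mono_on I f" and g: "strict_mono_on I g"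
    and le: "two_point_le I f g"
    and x: "x \<in> I" and y: "y \<in> I" and t: "x < t" "t < y" "t \<in> cont_pts I g"
  shows "(f y - f t) / (f y - f x) \<le> (g y - g t) / (g y - g x)"
proof (rule ccontr)
  let ?\<theta> = "(f y - f t) / (f y - f x)"
  assume "\<not> ?thesis"
  then have "(g y - g t) / (g y - g x) < ?\<theta>" by simp
  then obtain r where r: "r \<in> \<rat>" "(g y - g t) / (g y - g x) < r" "r < ?\<theta>"
    using Rats_dense_in_real by blast
  have tI: "t \<in> I" using t by (simp add: cont_pts_def)
  have fs: "f x < f t" "f t < f y" and gs: "g x < g t" "g t < g y"
    using f g x y tI t by (auto intro: strict_mono_onD)
  have "0 < (g y - g t) / (g y - g x)" "?\<theta> < 1" using fs gs by (auto simp: field_simps)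
  then have r01: "0 < r" "r < 1" using r by linarith+
  let ?u = "r * f x + (1 - r) * f y" and ?v = "r * g x + (1 - r) * g y"
  have comb: "r * h x + (1 - r) * h y \<in> conv (h ` I)" for h :: "real \<Rightarrow> real"
    using convexD[OF conv_image_convex image_in_conv[OF x] image_in_conv[OF y], of r "1 - r" h] r01
    by simp
  have "r * (f y - f x) < f y - f t" using r(3) fs by (simp add: field_simps)
  then have "f t \<le> ?u" by (simp add: algebra_simps)
  then have "gen_inv I f (f t) \<le> gen_inv I f ?u"
    using gen_inv_mono[OF I(2) f image_in_conv[OF tI] comb] by simp
  also have "\<dots> \<le> gen_inv I g ?v"
    using le x y r r01 unfolding two_point_le_def by auto
  finally have "t \<le> gen_inv I g ?v" using gen_inv_image[OF I(2) f tI] by simp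
  then have "g t \<le> ?v" using le_of_le_gen_inv[OF I g t(3) comb] by simp
  moreover have "g y - g t < r * (g y - g x)" using r(2) gs by (simp add: field_simps)
  ultimately show False by (simp add: algebra_simps)
qed

text \<open>In (iv) the quotients to the right of \<open>t\<close> are bounded by those to the left of \<open>t\<close>;
  the supremum of the former is a possible \<open>p(t)\<close>.\<close>

lemma slope_at_point:
  fixes I :: "real set" and f g :: "real \<Rightarrow> real"
  assumes I: "open I" and f: "strict_mono_on I f" and g: "strict_mono_on I g" and tI: "t \<in> I"
    and le: "\<And>x y. x \<in> I \<Longrightarrow> y \<in> I \<Longrightarrow> x < t \<Longrightarrow> t < y \<Longrightarrow>
      (f y - f t) / (f y - f x) \<le> (g y - g t) / (g y - g x)"
  shows "\<exists>q>0. \<forall>x\<in>I. f x - f t \<le> q * (g x - g t)"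
proof -
  let ?R = "\<lambda>y. (f y - f t) / (g y - g t)"
  let ?Y = "{y\<in>I. t < y}"
  define q where "q = (SUP y\<in>?Y. ?R y)"
  obtain a b where ab: "a \<in> I" "b \<in> I" "a < t" "t < b" using open_interval_nbhd[OF I tI] by blast
  have right: "f t < f y" "g t < g y" if "y \<in> ?Y" for y
    using f g tI that by (auto intro: strict_mono_onD)
  have left: "f x < f t" "g x < g t" if "x \<in> I" "x < t" for x
    using f g tI that by (auto intro: strict_mono_onD)
  have cross: "?R y \<le> (f t - f x) / (g t - g x)" if x: "x \<in> I" "x < t" and y: "y \<in> ?Y" for x y
  proof -
    have "(f y - f t) * (g y - g x) \<le> (g y - g t) * (f y - f x)"
      using le[of x y] x y left[OF x] right[OF y] by (simp add: divide_simps mult.commute)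
    then have "(f y - f t) * (g t - g x) \<le> (f t - f x) * (g y - g t)"
      by (simp add: algebra_simps)
    then show ?thesis using left[OF x] right[OF y] by (simp add: divide_simps mult.commute)
  qed
  have bdd: "bdd_above (?R ` ?Y)" using cross ab by (intro bdd_aboveI2) blast
  have up: "?R y \<le> q" if "y \<in> ?Y" for y
    unfolding q_def using bdd that by (intro cSUP_upper)
  have down: "q \<le> (f t - f x) / (g t - g x)" if "x \<in> I" "x < t" for x
    unfolding q_def using cross ab that by (intro cSUP_least) auto
  have "0 < ?R b" using right[of b] ab by simp
  then have "0 < q" using up[of b] ab by simp
  moreover have "f x - f t \<le> q * (g x - g t)" if x: "x \<in> I" for x
  proof -
    consider "x < t" | "x = t" | "t < x" by linarith
    then show ?thesis
    proof cases
      case 1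
      then have "q * (g t - g x) \<le> f t - f x"
        using down[OF x] left[OF x] by (simp add: field_simps)
      then show ?thesis by (simp add: algebra_simps)
    next
      case 3
      then show ?thesis using up[of x] right[of x] x by (simp add: field_simps)
    qed simp
  qed
  ultimately show ?thesis by blast
qed

section \<open>The convex homeomorphism\<close>

lemma SUP_lines_convex_mono:
  fixes f g p :: "real \<Rightarrow> real" and D J :: "real set"
  defines "\<phi> \<equiv> \<lambda>u. SUP t\<in>D. g t + (u - f t) / p t"
  assumes D: "D \<noteq> {}" and p: "\<And>t. t \<in> D \<Longrightarrow> 0 < p t" and J: "convex J"
    and bdd: "\<And>u. u \<in> J \<Longrightarrow> bdd_above ((\<lambda>t. g t + (u - f t) / p t) ` D)"
  shows "convex_on J \<phi>" "mono_on J \<phi>"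
proof -
  have eq: "\<phi> u = (SUP t\<in>D. g t + (u - f t) / p t)" for u by (simp add: \<phi>_def)
  have up: "g t + (u - f t) / p t \<le> \<phi> u" if "t \<in> D" "u \<in> J" for t u
    unfolding eq using that by (intro cSUP_upper bdd)
  show "convex_on J \<phi>"
  proof (rule convex_onI[OF _ J])
    fix s x y :: real assume s: "0 < s" "s < 1" and xy: "x \<in> J" "y \<in> J"
    show "\<phi> ((1 - s) *\<^sub>R x + s *\<^sub>R y) \<le> (1 - s) * \<phi> x + s * \<phi> y"
      unfolding eq[of "(1 - s) *\<^sub>R x + s *\<^sub>R y"]
    proof (rule cSUP_least[OF D])
      fix t assume t: "t \<in> D"
      have "g t + ((1 - s) *\<^sub>R x + s *\<^sub>R y - f t) / p t
          = (1 - s) * (g t + (x - f t) / p t) + s * (g t + (y - f t) / p t)"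
        using p[OF t] by (simp add: field_simps)
      also have "\<dots> \<le> (1 - s) * \<phi> x + s * \<phi> y"
        using up t xy s by (intro add_mono mult_left_mono) auto
      finally show "g t + ((1 - s) *\<^sub>R x + s *\<^sub>R y - f t) / p t \<le> (1 - s) * \<phi> x + s * \<phi> y" .
    qed
  qed
  show "mono_on J \<phi>"
  proof (rule mono_onI)
    fix u v assume uv: "u \<in> J" "v \<in> J" "u \<le> v"
    show "\<phi> u \<le> \<phi> v"
      unfolding eq[of u]
    proof (rule cSUP_least[OF D])
      fix t assume t: "t \<in> D"
      have "g t + (u - f t) / p t \<le> g t + (v - f t) / p t"
        using p[OF t] uv by (simp add: divide_right_mono)
      also have "\<dots> \<le> \<phi> v" using up t uv by simp
      finally show "g t + (u - f t) / p t \<le> \<phi> v" .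
    qed
  qed
qed

text \<open>The slopes of the chords of a convex function increase from left to right, hence a positive
  slope to the left of \<open>u\<close> stays positive.  A supremum of increasing lines is a priori only
  nondecreasing; this is what makes it injective.\<close>

lemma convex_strict_mono_after_increase:
  fixes \<phi> :: "real \<Rightarrow> real"
  assumes "convex_on J \<phi>" "a \<in> J" "v \<in> J" and "a < b" "b < u" "u < v" and ab: "\<phi> a < \<phi> b"
    and bu: "\<phi> b \<le> \<phi> u" and J: "convex J"
  shows "\<phi> u < \<phi> v"
proof -
  have uJ: "u \<in> J"
    using J assms unfolding is_interval_convex_1[symmetric] is_interval_1
    by (meson less_imp_le less_trans)
  have "0 < (\<phi> a - \<phi> u) / (a - u)" using assms by (intro divide_neg_neg) auto
  also have "\<dots> \<le> (\<phi> a - \<phi> v) / (a - v)"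
    using convex_on_slope_le(1)[OF assms(1,2,3), of u] assms by simp
  also have "\<dots> \<le> (\<phi> u - \<phi> v) / (u - v)"
    using convex_on_slope_le(2)[OF assms(1,2,3), of u] assms by simp
  finally show ?thesis using assms by (simp add: zero_less_divide_iff)
qed

lemma convex_homeomorphism_of_slopes:
  fixes I :: "real set" and f g p :: "real \<Rightarrow> real"
  assumes I: "open I" "is_interval I" "I \<noteq> {}"
    and f: "strict_mono_on I f" and g: "strict_mono_on I g"
    and p: "\<And>t. t \<in> cont_pts I f \<inter> cont_pts I g \<Longrightarrow> 0 < p t"
    and le: "\<And>x t. x \<in> I \<Longrightarrow> t \<in> cont_pts I f \<inter> cont_pts I g \<Longrightarrow> f x - f t \<le> p t * (g x - g t)"
  shows "\<exists>\<phi>. mono_on (conv (f ` I)) \<phi> \<and> convex_on (conv (f ` I)) \<phi> \<and>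
      (\<exists>\<phi>'. homeomorphism (conv (f ` I)) (conv (g ` I)) \<phi> \<phi>') \<and>
      (\<forall>x\<in>I. \<phi> (f x) \<le> g x) \<and> (\<forall>t \<in> cont_pts I f \<inter> cont_pts I g. \<phi> (f t) = g t)"
proof -
  let ?C = "cont_pts I f \<inter> cont_pts I g"
  let ?Jf = "conv (f ` I)" and ?Jg = "conv (g ` I)"
  let ?L = "\<lambda>u t. g t + (u - f t) / p t"
  define \<phi> where "\<phi> = (\<lambda>u. SUP t\<in>?C. ?L u t)"
  have CI: "t \<in> I" if "t \<in> ?C" for t using that by (auto simp: cont_pts_def)
  have fC: "f t \<in> ?Jf" and gC: "g t \<in> ?Jg" if "t \<in> ?C" for t
    using that CI by (auto intro: image_in_conv)
  note bounds_f = conv_image_bounds_cont_pts[OF I(1,2) f g f]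
    and bounds_g = conv_image_bounds_cont_pts[OF I(1,2) f g g]
  obtain x0 where "x0 \<in> I" using I by blast
  then have C: "?C \<noteq> {}"
    using bounds_f[OF image_in_conv] by blast
  have line: "?L (f x) t \<le> g x" if x: "x \<in> I" and t: "t \<in> ?C" for x t
    using le[OF x t] p[OF t] by (simp add: field_simps)
  have bdd: "bdd_above (?L u ` ?C)" if "u \<in> ?Jf" for u
  proof -
    obtain x where x: "x \<in> I" "u \<le> f x" using conv_image_bounds[OF \<open>u \<in> ?Jf\<close>] by blast
    have "?L u t \<le> g x" if t: "t \<in> ?C" for t
    proof -
      have "?L u t \<le> ?L (f x) t" using p[OF t] x by (simp add: divide_right_mono)
      then show ?thesis using line[OF x(1) t] by simp
    qed
    then show ?thesis by (rule bdd_aboveI2)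
  qed
  have convex: "convex_on ?Jf \<phi>" and mono: "mono_on ?Jf \<phi>"
    unfolding \<phi>_def by (rule SUP_lines_convex_mono[OF C p conv_image_convex bdd]; assumption)+
  have below: "\<phi> (f x) \<le> g x" if "x \<in> I" for x
    unfolding \<phi>_def using line that by (intro cSUP_least[OF C]) auto
  have eq: "\<phi> (f t) = g t" if t: "t \<in> ?C" for t
  proof (rule antisym)
    show "\<phi> (f t) \<le> g t" using below CI t by blast
    have "?L (f t) t \<le> \<phi> (f t)"
      unfolding \<phi>_def using t by (intro cSUP_upper bdd fC)
    then show "g t \<le> \<phi> (f t)" by simp
  qed
  have less: "\<phi> u < \<phi> v" if uv: "u \<in> ?Jf" "v \<in> ?Jf" "u < v" for u v
  proof -
    obtain b where b: "b \<in> ?C" "f b < u" using bounds_f[OF uv(1)] by blast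
    obtain a where a: "a \<in> ?C" "f a < f b" using bounds_f[OF fC[OF b(1)]] by blast
    have "a < b"
      using a b CI f by (meson strict_mono_on_less)
    then have "g a < g b" using a b CI g by (meson strict_mono_onD)
    moreover have "\<phi> (f b) \<le> \<phi> u" using mono b uv fC by (auto intro: mono_onD)
    ultimately show ?thesis
      using convex_strict_mono_after_increase[OF convex fC[OF a(1)] uv(2) a(2) b(2) uv(3)]
        eq[OF a(1)] eq[OF b(1)] conv_image_convex[of f I] by simp
  qed
  have inj: "inj_on \<phi> ?Jf"
    by (rule inj_onI) (metis less less_irrefl linorder_neqE_linordered_idom)
  have cont: "continuous_on ?Jf \<phi>"
    using convex_on_continuous[OF conv_image_open[OF I(1,2) f] convex] .
  have image: "\<phi> ` ?Jf = ?Jg"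
  proof
    show "\<phi> ` ?Jf \<subseteq> ?Jg"
    proof (rule image_subsetI)
      fix u assume u: "u \<in> ?Jf"
      obtain s t where st: "s \<in> ?C" "t \<in> ?C" "f s < u" "u < f t" using bounds_f[OF u] by blast
      then have "\<phi> (f s) \<le> \<phi> u" "\<phi> u \<le> \<phi> (f t)"
        using mono u fC by (auto intro!: mono_onD[OF mono])
      then show "\<phi> u \<in> ?Jg"
        using eq st CI by (auto intro!: conv_image_between[of s I t])
    qed
    \<comment> \<open>The image is an interval that contains \<open>g(C)\<close>, and \<open>g(C)\<close> is cofinal in both directions.\<close>
    have "connected (\<phi> ` ?Jf)"
      using cont conv_image_convex by (intro connected_continuous_image convex_connected)
    then have interval: "is_interval (\<phi> ` ?Jf)" by (simp add: is_interval_connected_1)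
    show "?Jg \<subseteq> \<phi> ` ?Jf"
    proof
      fix v assume v: "v \<in> ?Jg"
      obtain s t where st: "s \<in> ?C" "t \<in> ?C" "g s < v" "v < g t" using bounds_g[OF v] by blast
      have "g s \<in> \<phi> ` ?Jf" "g t \<in> \<phi> ` ?Jf"
        using st eq fC by (metis image_eqI)+
      then show "v \<in> \<phi> ` ?Jf"
        using interval st unfolding is_interval_1 by (meson less_imp_le)
    qed
  qed
  obtain \<phi>' where "homeomorphism ?Jf (\<phi> ` ?Jf) \<phi> \<phi>'"
    using invariance_of_domain_homeomorphism[OF conv_image_open[OF I(1,2) f] cont _ inj] by auto
  then have "homeomorphism ?Jf ?Jg \<phi> \<phi>'" using image by simp
  then show ?thesis using mono convex below eq by blast
qed

section \<open>From the convex homeomorphism to the means\<close>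

text \<open>On \<open>f(C)\<close> the two sides agree, because there \<open>\<phi>(f(t)) = g(t)\<close>.  They agree everywhere because
  both are increasing and their common values on \<open>f(C)\<close> form the dense set \<open>C\<close>.\<close>

lemma gen_inv_comp_homeomorphism:
  fixes I :: "real set" and f g \<phi> :: "real \<Rightarrow> real"
  assumes I: "open I" "is_interval I" and f: "strict_mono_on I f" and g: "strict_mono_on I g"
    and mono: "mono_on (conv (f ` I)) \<phi>" and image: "\<phi> ` conv (f ` I) \<subseteq> conv (g ` I)"
    and eq: "\<And>t. t \<in> cont_pts I f \<inter> cont_pts I g \<Longrightarrow> \<phi> (f t) = g t"
    and u: "u \<in> conv (f ` I)"
  shows "gen_inv I g (\<phi> u) = gen_inv I f u"
proof -
  let ?C = "cont_pts I f \<inter> cont_pts I g"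
  let ?G = "\<lambda>u. gen_inv I g (\<phi> u)"
  have CI: "t \<in> I" if "t \<in> ?C" for t using that by (auto simp: cont_pts_def)
  have G_mem: "?G u \<in> I" using gen_inv_mem[OF I(2) g] image u by blast
  have F_mem: "gen_inv I f u \<in> I" using gen_inv_mem[OF I(2) f u] .
  have G_mono: "?G v \<le> ?G w" if "v \<in> conv (f ` I)" "w \<in> conv (f ` I)" "v \<le> w" for v w
    using gen_inv_mono[OF I(2) g] image mono_onD[OF mono] that by blast
  note F_mono = gen_inv_mono[OF I(2) f]
  have F_C: "gen_inv I f (f t) = t" and G_C: "?G (f t) = t" and fC: "f t \<in> conv (f ` I)"
    if "t \<in> ?C" for t
    using gen_inv_image[OF I(2) f] gen_inv_image[OF I(2) g] CI[OF that] eq[OF that] image_in_conv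
    by auto
  \<comment> \<open>A point \<open>t\<close> of \<open>C\<close> strictly between the two values would have \<open>f(t)\<close> both above and below \<open>u\<close>.\<close>
  show ?thesis
  proof (rule ccontr)
    assume "?G u \<noteq> gen_inv I f u"
    then consider "?G u < gen_inv I f u" | "gen_inv I f u < ?G u" by linarith
    then show False
    proof cases
      case 1
      then obtain t where t: "t \<in> ?C" "?G u < t" "t < gen_inv I f u"
        using cont_pts_dense[OF I(2) f g G_mem F_mem] by blast
      then show False
        using F_mono[OF u fC] G_mono[OF fC u] F_C G_C by (metis linear not_le)
    next
      case 2
      then obtain t where t: "t \<in> ?C" "gen_inv I f u < t" "t < ?G u"
        using cont_pts_dense[OF I(2) f g F_mem G_mem] by blast
      then show False
        using F_mono[OF fC u] G_mono[OF u fC] F_C G_C by (metis linear not_le)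
    qed
  qed
qed

lemma wqa_mean_le_of_convex:
  fixes I :: "real set" and f g \<phi> :: "real \<Rightarrow> real"
  assumes I: "open I" "is_interval I" and f: "strict_mono_on I f" and g: "strict_mono_on I g"
    and mono: "mono_on (conv (f ` I)) \<phi>" and convex: "convex_on (conv (f ` I)) \<phi>"
    and image: "\<phi> ` conv (f ` I) \<subseteq> conv (g ` I)"
    and below: "\<And>x. x \<in> I \<Longrightarrow> \<phi> (f x) \<le> g x"
    and eq: "\<And>t. t \<in> cont_pts I f \<inter> cont_pts I g \<Longrightarrow> \<phi> (f t) = g t"
    and x: "x \<in> {1..n} \<rightarrow> I" and l: "l \<in> weights n"
  shows "wqa_mean I f n x l \<le> wqa_mean I g n x l"
proof -
  let ?S = "\<Sum>i=1..n. l i"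
  have l0: "0 \<le> l i" if "i \<in> {1..n}" for i
    using l that by (auto simp: weights_def)
  have S: "0 < ?S" using l by (simp add: weights_def)
  then have ne: "{1..n} \<noteq> {}" by force
  have wt1: "(\<Sum>i=1..n. l i / ?S) = 1" using S by (simp flip: sum_divide_distrib)
  have wt0: "0 \<le> l i / ?S" if "i \<in> {1..n}" for i using l0[OF that] S by simp
  have avg: "(\<Sum>i=1..n. l i * h (x i)) / ?S = (\<Sum>i=1..n. (l i / ?S) *\<^sub>R h (x i))"
    for h :: "real \<Rightarrow> real"
    by (simp add: sum_divide_distrib)
  have mem: "(\<Sum>i=1..n. (l i / ?S) *\<^sub>R h (x i)) \<in> conv (h ` I)" for h :: "real \<Rightarrow> real"
    using x wt0 wt1 by (intro convex_sum conv_image_convex image_in_conv) auto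
  let ?u = "\<Sum>i=1..n. (l i / ?S) *\<^sub>R f (x i)" and ?v = "\<Sum>i=1..n. (l i / ?S) *\<^sub>R g (x i)"
  have "\<phi> ?u \<le> (\<Sum>i=1..n. l i / ?S * \<phi> (f (x i)))"
    using x wt0 wt1 ne by (intro convex_on_sum[OF _ _ convex] image_in_conv) auto
  also have "\<dots> \<le> ?v"
    unfolding real_scaleR_def using x wt0 below by (intro sum_mono mult_left_mono) (auto simp: Pi_iff)
  finally have "gen_inv I g (\<phi> ?u) \<le> gen_inv I g ?v"
    using gen_inv_mono[OF I(2) g] mem image by blast
  then have "gen_inv I f ?u \<le> gen_inv I g ?v"
    using gen_inv_comp_homeomorphism[OF I f g mono image eq mem] by simp
  then show ?thesis by (simp only: wqa_mean_def avg)
qed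

section \<open>Inverting the homeomorphism\<close>

lemma homeomorphism_inverse_mono:
  fixes \<phi> \<phi>' :: "real \<Rightarrow> real"
  assumes h: "homeomorphism A B \<phi> \<phi>'" and mono: "mono_on A \<phi>"
  shows "mono_on B \<phi>'"
proof (rule mono_onI)
  fix y z assume yz: "y \<in> B" "z \<in> B" "y \<le> z"
  have A: "\<phi>' y \<in> A" "\<phi>' z \<in> A" and inv: "\<phi> (\<phi>' y) = y" "\<phi> (\<phi>' z) = z"
    using h yz by (auto simp: homeomorphism_def)
  show "\<phi>' y \<le> \<phi>' z"
  proof (rule ccontr)
    assume "\<not> \<phi>' y \<le> \<phi>' z"
    then have "\<phi> (\<phi>' z) \<le> \<phi> (\<phi>' y)" using mono_onD[OF mono A(2,1)] by simp
    then have "y = z" using inv yz by simp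
    then show False using \<open>\<not> \<phi>' y \<le> \<phi>' z\<close> by simp
  qed
qed

text \<open>Reflecting the graph of an increasing function in the diagonal exchanges the regions above
  and below it.  The two lemmas are mirror images of each other.\<close>

lemma homeomorphism_inverse_concave:
  fixes \<phi> \<phi>' :: "real \<Rightarrow> real"
  assumes h: "homeomorphism A B \<phi> \<phi>'" and mono: "mono_on A \<phi>"
    and convex: "convex_on A \<phi>" and B: "convex B"
  shows "concave_on B \<phi>'"
  unfolding concave_on_def
proof (rule convex_onI[OF _ B])
  fix s y z :: real assume s: "0 < s" "s < 1" and yz: "y \<in> B" "z \<in> B"
  let ?m = "(1 - s) *\<^sub>R \<phi>' y + s *\<^sub>R \<phi>' z" and ?w = "(1 - s) *\<^sub>R y + s *\<^sub>R z"
  have A: "\<phi>' y \<in> A" "\<phi>' z \<in> A" and inv: "\<phi> (\<phi>' y) = y" "\<phi> (\<phi>' z) = z"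
    using h yz by (auto simp: homeomorphism_def)
  have m: "?m \<in> A" using convexD[OF convex_on_imp_convex[OF convex] A, of "1 - s" s] s by simp
  have w: "?w \<in> B" using convexD[OF B yz, of "1 - s" s] s by simp
  have image: "\<phi> ?m \<in> B" using h m unfolding homeomorphism_def by blast
  have "\<phi> ?m \<le> ?w" using convex_onD[OF convex _ _ A, of s] s inv by simp
  then have "\<phi>' (\<phi> ?m) \<le> \<phi>' ?w"
    using mono_onD[OF homeomorphism_inverse_mono[OF h mono] image w] by simp
  moreover have "\<phi>' (\<phi> ?m) = ?m" using h m unfolding homeomorphism_def by blast
  ultimately show "- \<phi>' ?w \<le> (1 - s) * - \<phi>' y + s * - \<phi>' z" by simp
qed

lemma homeomorphism_inverse_convex:
  fixes \<psi> \<psi>' :: "real \<Rightarrow> real"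
  assumes h: "homeomorphism A B \<psi> \<psi>'" and mono: "mono_on A \<psi>"
    and concave: "concave_on A \<psi>" and B: "convex B"
  shows "convex_on B \<psi>'"
proof (rule convex_onI[OF _ B])
  fix s y z :: real assume s: "0 < s" "s < 1" and yz: "y \<in> B" "z \<in> B"
  let ?m = "(1 - s) *\<^sub>R \<psi>' y + s *\<^sub>R \<psi>' z" and ?w = "(1 - s) *\<^sub>R y + s *\<^sub>R z"
  have A: "\<psi>' y \<in> A" "\<psi>' z \<in> A" and inv: "\<psi> (\<psi>' y) = y" "\<psi> (\<psi>' z) = z"
    using h yz by (auto simp: homeomorphism_def)
  have convex: "convex_on A (\<lambda>x. - \<psi> x)" using concave by (simp add: concave_on_def)
  have m: "?m \<in> A" using convexD[OF convex_on_imp_convex[OF convex] A, of "1 - s" s] s by simp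
  have w: "?w \<in> B" using convexD[OF B yz, of "1 - s" s] s by simp
  have image: "\<psi> ?m \<in> B" using h m unfolding homeomorphism_def by blast
  have "?w \<le> \<psi> ?m" using convex_onD[OF convex _ _ A, of s] s inv by simp
  then have "\<psi>' ?w \<le> \<psi>' (\<psi> ?m)"
    using mono_onD[OF homeomorphism_inverse_mono[OF h mono] w image] by simp
  moreover have "\<psi>' (\<psi> ?m) = ?m" using h m unfolding homeomorphism_def by blast
  ultimately show "\<psi>' ?w \<le> (1 - s) * \<psi>' y + s * \<psi>' z" by simp
qed

section \<open>Comparison of generalized quasiarithmetic means\<close>

theorem theorem3p5:
  fixes I :: "real set" and f g :: "real \<Rightarrow> real"
  assumes "open I" and "is_interval I" and "I \<noteq> {}"
    and "strict_mono_on I f" and "strict_mono_on I g"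
  shows "TFAE [
    \<forall>n\<ge>1. \<forall>x \<in> {1..n} \<rightarrow> I. qa_mean I f n x \<le> qa_mean I g n x,
    \<forall>n\<ge>1. \<forall>x \<in> {1..n} \<rightarrow> I. \<forall>l \<in> weights n. wqa_mean I f n x l \<le> wqa_mean I g n x l,
    \<exists>n\<ge>2. \<forall>x \<in> {1..n} \<rightarrow> I. \<forall>l \<in> weights n. wqa_mean I f n x l \<le> wqa_mean I g n x l,
    \<forall>x\<in>I. \<forall>y\<in>I. x < y \<longrightarrow> (\<forall>t \<in> {x<..<y} \<inter> cont_pts I f \<inter> cont_pts I g.
      (f y - f t) / (f y - f x) \<le> (g y - g t) / (g y - g x)),
    \<exists>p :: real \<Rightarrow> real. (\<forall>t \<in> cont_pts I f \<inter> cont_pts I g. 0 < p t) \<and>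
      (\<forall>x\<in>I. \<forall>t \<in> cont_pts I f \<inter> cont_pts I g. f x - f t \<le> p t * (g x - g t)),
    \<exists>\<phi>. mono_on (conv (f ` I)) \<phi> \<and> convex_on (conv (f ` I)) \<phi> \<and>
      (\<exists>\<phi>'. homeomorphism (conv (f ` I)) (conv (g ` I)) \<phi> \<phi>') \<and>
      (\<forall>x\<in>I. \<phi> (f x) \<le> g x) \<and>
      (\<forall>t \<in> cont_pts I f \<inter> cont_pts I g. \<phi> (f t) = g t),
    \<exists>\<psi>. mono_on (conv (g ` I)) \<psi> \<and> concave_on (conv (g ` I)) \<psi> \<and>
      (\<exists>\<psi>'. homeomorphism (conv (g ` I)) (conv (f ` I)) \<psi> \<psi>') \<and>
      (\<forall>x\<in>I. f x \<le> \<psi> (g x)) \<and>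
      (\<forall>t \<in> cont_pts I f \<inter> cont_pts I g. f t = \<psi> (g t))]"
proof -
  let ?C = "cont_pts I f \<inter> cont_pts I g"
  let ?Jf = "conv (f ` I)" and ?Jg = "conv (g ` I)"
  let ?i = "\<forall>n\<ge>1. \<forall>x \<in> {1..n} \<rightarrow> I. qa_mean I f n x \<le> qa_mean I g n x"
  let ?ii = "\<forall>n\<ge>1. \<forall>x \<in> {1..n} \<rightarrow> I. \<forall>l \<in> weights n. wqa_mean I f n x l \<le> wqa_mean I g n x l"
  let ?iii = "\<exists>n\<ge>2. \<forall>x \<in> {1..n} \<rightarrow> I. \<forall>l \<in> weights n. wqa_mean I f n x l \<le> wqa_mean I g n x l"
  let ?iv = "\<forall>x\<in>I. \<forall>y\<in>I. x < y \<longrightarrow> (\<forall>t \<in> {x<..<y} \<inter> cont_pts I f \<inter> cont_pts I g.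
      (f y - f t) / (f y - f x) \<le> (g y - g t) / (g y - g x))"
  let ?v = "\<exists>p :: real \<Rightarrow> real. (\<forall>t \<in> ?C. 0 < p t) \<and>
      (\<forall>x\<in>I. \<forall>t \<in> ?C. f x - f t \<le> p t * (g x - g t))"
  let ?vi = "\<exists>\<phi>. mono_on ?Jf \<phi> \<and> convex_on ?Jf \<phi> \<and> (\<exists>\<phi>'. homeomorphism ?Jf ?Jg \<phi> \<phi>') \<and>
      (\<forall>x\<in>I. \<phi> (f x) \<le> g x) \<and> (\<forall>t \<in> ?C. \<phi> (f t) = g t)"
  let ?vii = "\<exists>\<psi>. mono_on ?Jg \<psi> \<and> concave_on ?Jg \<psi> \<and> (\<exists>\<psi>'. homeomorphism ?Jg ?Jf \<psi> \<psi>') \<and>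
      (\<forall>x\<in>I. f x \<le> \<psi> (g x)) \<and> (\<forall>t \<in> ?C. f t = \<psi> (g t))"
  note I = assms(1-3) and f = assms(4) and g = assms(5)
  have CI: "t \<in> I" if "t \<in> ?C" for t using that by (auto simp: cont_pts_def)
  have fJ: "f x \<in> ?Jf" and gJ: "g x \<in> ?Jg" if "x \<in> I" for x
    using that by (auto intro: image_in_conv)

  have i_two: "two_point_le I f g" if ?i
    using that by (rule two_point_le_of_qa_mean)
  have iii_two: "two_point_le I f g" if ?iii
    using that two_point_le_of_wqa_mean by blast
  have two_iv: ?iv if "two_point_le I f g"
    using slopes_of_two_point_means[OF I(1,2) f g that] by simp
  have iv_v: ?v if iv: ?iv
  proof -
    have "\<forall>t\<in>?C. \<exists>q>0. \<forall>x\<in>I. f x - f t \<le> q * (g x - g t)"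
    proof
      fix t assume t: "t \<in> ?C"
      show "\<exists>q>0. \<forall>x\<in>I. f x - f t \<le> q * (g x - g t)"
      proof (rule slope_at_point[OF I(1) f g CI[OF t]])
        fix x y assume "x \<in> I" "y \<in> I" "x < t" "t < y"
        then show "(f y - f t) / (f y - f x) \<le> (g y - g t) / (g y - g x)"
          using iv[rule_format, of x y t] t by auto
      qed
    qed
    then obtain p where "\<forall>t\<in>?C. 0 < p t \<and> (\<forall>x\<in>I. f x - f t \<le> p t * (g x - g t))"
      by metis
    then show ?v by blast
  qed
  have v_vi: ?vi if ?v
    using that convex_homeomorphism_of_slopes[OF I f g] by blast
  have vi_ii: ?ii if ?vi
  proof -
    obtain \<phi> \<phi>' where \<phi>: "mono_on ?Jf \<phi>" "convex_on ?Jf \<phi>" "homeomorphism ?Jf ?Jg \<phi> \<phi>'"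
      "\<forall>x\<in>I. \<phi> (f x) \<le> g x" "\<forall>t\<in>?C. \<phi> (f t) = g t"
      using \<open>?vi\<close> by blast
    then have "\<phi> ` ?Jf \<subseteq> ?Jg" by (simp add: homeomorphism_def)
    then show ?ii using wqa_mean_le_of_convex[OF I(1,2) f g \<phi>(1,2)] \<phi>(4,5) by blast
  qed
  have ii_i: ?i if ii: ?ii
  proof (intro allI impI ballI)
    fix n :: nat and x assume n: "1 \<le> n" and x: "x \<in> {1..n} \<rightarrow> I"
    have "(\<lambda>_. 1) \<in> weights n" using n by (simp add: weights_def)
    then have "wqa_mean I f n x (\<lambda>_. 1) \<le> wqa_mean I g n x (\<lambda>_. 1)" using ii n x by blast
    then show "qa_mean I f n x \<le> qa_mean I g n x" by (simp add: wqa_mean_def qa_mean_def)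
  qed
  have ii_iii: ?iii if ii: ?ii
    using ii by (intro exI[of _ 2]) simp
  have vi_vii: ?vii if ?vi
  proof -
    obtain \<phi> \<phi>' where \<phi>: "mono_on ?Jf \<phi>" "convex_on ?Jf \<phi>" and h: "homeomorphism ?Jf ?Jg \<phi> \<phi>'"
      and below: "\<forall>x\<in>I. \<phi> (f x) \<le> g x" and eq: "\<forall>t\<in>?C. \<phi> (f t) = g t"
      using \<open>?vi\<close> by blast
    have inv: "\<phi>' (\<phi> (f x)) = f x" and mem: "\<phi> (f x) \<in> ?Jg" if "x \<in> I" for x
      using h fJ[OF that] by (auto simp: homeomorphism_def)
    have mono': "mono_on ?Jg \<phi>'" using homeomorphism_inverse_mono[OF h \<phi>(1)] .
    have "f x \<le> \<phi>' (g x)" if "x \<in> I" for x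
      using mono_onD[OF mono' mem[OF that] gJ[OF that]] below inv that by simp
    moreover have "f t = \<phi>' (g t)" if "t \<in> ?C" for t
      using inv[OF CI[OF that]] eq that by simp
    ultimately show ?vii
      using mono' homeomorphism_inverse_concave[OF h \<phi> conv_image_convex] homeomorphism_symD[OF h]
      by blast
  qed
  have vii_vi: ?vi if ?vii
  proof -
    obtain \<psi> \<psi>' where \<psi>: "mono_on ?Jg \<psi>" "concave_on ?Jg \<psi>" and h: "homeomorphism ?Jg ?Jf \<psi> \<psi>'"
      and above: "\<forall>x\<in>I. f x \<le> \<psi> (g x)" and eq: "\<forall>t\<in>?C. f t = \<psi> (g t)"
      using \<open>?vii\<close> by blast
    have inv: "\<psi>' (\<psi> (g x)) = g x" and mem: "\<psi> (g x) \<in> ?Jf" if "x \<in> I" for x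
      using h gJ[OF that] by (auto simp: homeomorphism_def)
    have mono': "mono_on ?Jf \<psi>'" using homeomorphism_inverse_mono[OF h \<psi>(1)] .
    have "\<psi>' (f x) \<le> g x" if "x \<in> I" for x
      using mono_onD[OF mono' fJ[OF that] mem[OF that]] above inv that by simp
    moreover have "\<psi>' (f t) = g t" if "t \<in> ?C" for t
      using inv[OF CI[OF that]] eq that by simp
    ultimately show ?vi
      using mono' homeomorphism_inverse_convex[OF h \<psi> conv_image_convex] homeomorphism_symD[OF h]
      by blast
  qed
  have two_ii: ?ii if "two_point_le I f g"
    using vi_ii[OF v_vi[OF iv_v[OF two_iv[OF that]]]] .
  have ii_iv: ?iv if ?ii
    using two_iv[OF iii_two[OF ii_iii[OF that]]] .
  have "?i \<longleftrightarrow> ?ii" by (standard, erule two_ii[OF i_two], erule ii_i)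
  moreover have "?iii \<longleftrightarrow> ?ii" by (standard, erule two_ii[OF iii_two], erule ii_iii)
  moreover have "?iv \<longleftrightarrow> ?ii" by (standard, erule vi_ii[OF v_vi[OF iv_v]], erule ii_iv)
  moreover have "?v \<longleftrightarrow> ?ii" by (standard, erule vi_ii[OF v_vi], erule iv_v[OF ii_iv])
  moreover have "?vi \<longleftrightarrow> ?ii" by (standard, erule vi_ii, erule v_vi[OF iv_v[OF ii_iv]])
  moreover have "?vii \<longleftrightarrow> ?ii"
    by (standard, erule vi_ii[OF vii_vi], erule vi_vii[OF v_vi[OF iv_v[OF ii_iv]]])
  ultimately show ?thesis unfolding TFAE_def by (simp only: list.set ball_simps simp_thms)
qed

end
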